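(* Fix an integer $g\ge3$ and a real $\lambda>0$. For $n\ge1$ let $a=\lfloor\lambda n\rfloor$, $b=n^{g-2}$ and $c=n$. Color the vertices of the graph $G_{a,b,g}$ independently and uniformly at random with $c$ colors, and let $Z_{a,b,g}$ be the number of monochromatic $g$-cycles of $G_{a,b,g}$. Then, as $n\to\infty$, $Z_{a,b,g}$ converges in distribution to $\mathrm{Poisson}(W)$, where $W\sim\mathrm{Poisson}(\lambda)$.
   Context: For positive integers $a,b$ and $g\ge3$, the graph $G_{a,b,g}$ has vertex set $\{v_1,\dots,v_{a+1}\}\cup\{v_{ijk}: i\in[a],\,j\in[b],\,k\in\{1,\dots,g-2\}\}$; its edges are such that $v_1,v_2,\dots,v_{a+1}$ form a path of length $a$ and, for every $i\in[a]$ and $j\in[b]$, the vertices $v_i,v_{ij1},v_{ij2},\dots,v_{ij(g-2)},v_{i+1}$ form (in this cyclic order) a cycle of length $g$. If $Y_i$ is the color of $v_i$ and $Y_{ijk}$ the color of $v_{ijk}$, then $Z_{a,b,g}=\sum_{i=1}^a\sum_{j=1}^b\prod_{k=1}^{g-2}\mathbf{1}\{Y_i=Y_{i+1}=Y_{ijk}\}$. $\mathrm{Poisson}(W)$ denotes the mixed Poisson law with $\mathbb{P}(\mathrm{Poisson}(W)=k)=\mathbb{E}\left(\frac{1}{k!}e^{-W}W^k\right)$, $k\ge0$. *)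

theory Defs
  imports "HOL-Probability.Probability"
begin

section \<open>Cycles in finite simple graphs\<close>

text \<open>
  A graph is given by its vertex set \<open>V\<close> and its set \<open>E\<close> of edges, each edge being
  a two-element set of vertices.
\<close>

definition cycle_edges :: "'v list \<Rightarrow> 'v set set" where
  "cycle_edges xs = {{xs ! k, xs ! (Suc k mod length xs)} | k. k < length xs}"

text \<open>
  Cycles are counted as subgraphs. Since a cycle has no isolated vertices, it is identified with
  its edge set, so that the rotations and reflections of a vertex list give the same cycle.
\<close>

definition cycles :: "nat \<Rightarrow> 'v set \<Rightarrow> 'v set set \<Rightarrow> 'v set set set" where
  "cycles g V E = {cycle_edges xs | xs.
     length xs = g \<and> 3 \<le> g \<and> distinct xs \<and> set xs \<subseteq> V \<and> cycle_edges xs \<subseteq> E}"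

definition monochromatic :: "('v \<Rightarrow> 'c) \<Rightarrow> 'v set set \<Rightarrow> bool" where
  "monochromatic Y C \<longleftrightarrow> (\<exists>c. \<forall>v\<in>\<Union>C. Y v = c)"

definition num_mono_cycles :: "nat \<Rightarrow> 'v set \<Rightarrow> 'v set set \<Rightarrow> ('v \<Rightarrow> 'c) \<Rightarrow> nat" where
  "num_mono_cycles g V E Y = card {C \<in> cycles g V E. monochromatic Y C}"

definition uniform_coloring :: "'v set \<Rightarrow> nat \<Rightarrow> ('v \<Rightarrow> nat) pmf" where
  "uniform_coloring V c = Pi_pmf V 0 (\<lambda>_. pmf_of_set {1..c})"


section \<open>The graph $G_{a,b,g}$\<close>

text \<open>\<open>PathV i\<close> stands for $v_i$ and \<open>CycV i j k\<close> for $v_{ijk}$.\<close>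

datatype vertex = PathV nat | CycV nat nat nat

definition G_verts :: "nat \<Rightarrow> nat \<Rightarrow> nat \<Rightarrow> vertex set" where
  "G_verts a b g = PathV ` {1..a+1} \<union> {CycV i j k | i j k. i \<in> {1..a} \<and> j \<in> {1..b} \<and> k \<in> {1..g-2}}"

definition G_cycle :: "nat \<Rightarrow> nat \<Rightarrow> nat \<Rightarrow> vertex list" where
  "G_cycle g i j = PathV i # map (CycV i j) [1..<g-1] @ [PathV (i+1)]"

definition G_edges :: "nat \<Rightarrow> nat \<Rightarrow> nat \<Rightarrow> vertex set set" where
  "G_edges a b g = {{PathV i, PathV (i+1)} | i. i \<in> {1..a}} \<union>
     (\<Union>i\<in>{1..a}. \<Union>j\<in>{1..b}. cycle_edges (G_cycle g i j))"

definition Z :: "nat \<Rightarrow> nat \<Rightarrow> nat \<Rightarrow> (vertex \<Rightarrow> 'c) \<Rightarrow> nat" where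
  "Z a b g Y = num_mono_cycles g (G_verts a b g) (G_edges a b g) Y"


section \<open>The mixed Poisson distribution\<close>

text \<open>
  \<open>mixed_poisson M W\<close> is the law $\mathrm{Poisson}(W)$ for a nonnegative random variable \<open>W\<close> on the
  probability space \<open>M\<close>. The value $W = 0$ is allowed, which is why this is not defined as a mixture
  of \<^const>\<open>poisson_pmf\<close>: the latter requires a positive rate.
\<close>

definition mixed_poisson :: "'a measure \<Rightarrow> ('a \<Rightarrow> real) \<Rightarrow> nat pmf" where
  "mixed_poisson M W = embed_pmf (\<lambda>k. \<integral>\<omega>. 1 / fact k * exp (- W \<omega>) * W \<omega> ^ k \<partial>M)"

lemma pmf_mixed_poisson:
  assumes M: "prob_space M" and W [measurable]: "W \<in> borel_measurable M"
    and nonneg: "AE \<omega> in M. 0 \<le> W \<omega>"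
  shows "pmf (mixed_poisson M W) k = (\<integral>\<omega>. 1 / fact k * exp (- W \<omega>) * W \<omega> ^ k \<partial>M)"
proof -
  interpret prob_space M by fact
  let ?p = "\<lambda>k \<omega>. 1 / fact k * exp (- W \<omega>) * W \<omega> ^ k"
  have sums: "(\<lambda>k. 1 / fact k * exp (- w) * w ^ k) sums 1" for w :: real
  proof -
    have "(\<lambda>k. exp (- w) * (w ^ k /\<^sub>R fact k)) sums (exp (- w) * exp w)"
      by (intro sums_mult exp_converges)
    then show ?thesis by (simp add: mult_exp_exp field_simps)
  qed
  have le1: "1 / fact k * exp (- w) * w ^ k \<le> 1" if "0 \<le> w" for w :: real and k
  proof -
    have "(\<Sum>n\<in>{k}. 1 / fact n * exp (- w) * w ^ n) \<le> (\<Sum>n. 1 / fact n * exp (- w) * w ^ n)"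
      using that by (intro sum_le_suminf sums_summable[OF sums]) auto
    then show ?thesis using sums_unique[OF sums, of w] by simp
  qed
  have int: "integrable M (?p k)" for k
  proof (rule integrable_const_bound[where B = 1])
    show "AE \<omega> in M. norm (?p k \<omega>) \<le> 1"
      using nonneg by eventually_elim (use le1 in auto)
  qed measurable
  have nonneg': "0 \<le> (\<integral>\<omega>. ?p k \<omega> \<partial>M)" for k
    by (rule integral_nonneg_AE) (use nonneg in eventually_elim, simp)
  have nn: "ennreal (\<integral>\<omega>. ?p k \<omega> \<partial>M) = (\<integral>\<^sup>+\<omega>. ennreal (?p k \<omega>) \<partial>M)" for k
    by (rule nn_integral_eq_integral[symmetric, OF int]) (use nonneg in eventually_elim, simp)
  have "(\<integral>\<^sup>+k. ennreal (\<integral>\<omega>. ?p k \<omega> \<partial>M) \<partial>count_space UNIV) = (\<Sum>k. \<integral>\<^sup>+\<omega>. ennreal (?p k \<omega>) \<partial>M)"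
    by (simp only: nn_integral_count_space_nat nn)
  also have "\<dots> = (\<integral>\<^sup>+\<omega>. (\<Sum>k. ennreal (?p k \<omega>)) \<partial>M)"
    by (rule nn_integral_suminf[symmetric]) measurable
  also have "\<dots> = (\<integral>\<^sup>+\<omega>. 1 \<partial>M)"
  proof (rule nn_integral_cong_AE)
    show "AE \<omega> in M. (\<Sum>k. ennreal (?p k \<omega>)) = 1"
      using nonneg
    proof eventually_elim
      case (elim \<omega>)
      have "(\<Sum>k. ennreal (?p k \<omega>)) = ennreal 1"
        using elim by (intro suminf_ennreal_eq[OF _ sums]) auto
      then show ?case by simp
    qed
  qed
  also have "\<dots> = 1" by (simp add: emeasure_space_1)
  finally show ?thesis
    unfolding mixed_poisson_def using nonneg' by (intro pmf_embed_pmf) auto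
qed

end

theory Submission
  imports Defs "HOL-Real_Asymp.Real_Asymp"
begin

text \<open>
  The only cycles of length \<open>g\<close> in $G_{a,b,g}$ are the \<open>a * b\<close> cycles it is built from
  (\<open>cycles_G\<close>), so \<open>Z\<close> counts the monochromatic ones among these. The cycles with the same
  index \<open>i\<close> all need $Y_i = Y_{i+1}$, an event of probability $1/c$. Given this event, each of the
  \<open>b\<close> cycles is monochromatic with probability $c^{-(g-2)}$, independently of the others. Moreover
  the events for different \<open>i\<close> are independent, because $Y_{i+1}$ is uniform whatever $Y_i$ is. Hence
  \<open>Z\<close> is a sum of \<open>a\<close> independent copies of a binomial variable that is switched on with
  probability $1/c$, and its generating function is explicit (\<open>pgf_Z\<close>):
  \[ E(s^Z) = \Bigl(1 + \frac1c\Bigl(\Bigl(1 + \frac{s-1}{c^{g-2}}\Bigr)^b - 1\Bigr)\Bigr)^a. \]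

  With $b = c^{g-2}$, $c = n$ and $a \sim \lambda n$, the inner power tends to $e^{s-1}$ and the whole
  expression to $\exp(\lambda(e^{s-1} - 1))$ (\<open>pgf_limit\<close>). On the other side, conditioning on \<open>W\<close> gives
  $E(e^{W(s-1)})$ as the generating function of the mixed Poisson law (\<open>pgf_mixed_poisson\<close>), and
  for $W \sim \mathrm{Poisson}(\lambda)$ this is the generating function of \<open>W\<close> at $e^{s-1}$, that is, the
  same limit. Taking $s = e^{it}$ turns generating functions into characteristic functions, and
  Levy's continuity theorem concludes. This is why the generating functions are computed for complex \<open>s\<close>.
\<close>

section \<open>The cycles of length $g$\<close>

text \<open>
  The vertices of the \<open>(i, j)\<close> cycle, numbered from \<open>0\<close> to \<open>g - 1\<close> along the arc from $v_i$ to
  $v_{i+1}$, so that both path vertices are the ends of one uniform numbering and each edge other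
  than $v_i v_{i+1}$ joins consecutive numbers.
\<close>

definition cycle_node :: "nat \<Rightarrow> nat \<Rightarrow> nat \<Rightarrow> nat \<Rightarrow> vertex" where
  "cycle_node g i j k = (if k = 0 then PathV i else if k = g - 1 then PathV (i + 1) else CycV i j k)"

lemma length_G_cycle: "g \<ge> 2 \<Longrightarrow> length (G_cycle g i j) = g"
  by (auto simp: G_cycle_def)

lemma nth_G_cycle:
  assumes "g \<ge> 3" "k < g"
  shows "G_cycle g i j ! k = cycle_node g i j k"
proof (cases "k = 0 \<or> k = g - 1")
  case True
  with assms show ?thesis by (auto simp: G_cycle_def cycle_node_def nth_append)
next
  case False
  then obtain m where m: "k = Suc m" by (cases k) auto
  with False assms show ?thesis by (auto simp: G_cycle_def cycle_node_def nth_append)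
qed

lemma cycle_node_eq_iff:
  assumes "g \<ge> 3" "k < g" "m < g"
  shows "cycle_node g i j k = cycle_node g i j m \<longleftrightarrow> k = m"
  using assms by (auto simp: cycle_node_def)

lemma distinct_G_cycle: "g \<ge> 3 \<Longrightarrow> distinct (G_cycle g i j)"
  by (simp add: distinct_conv_nth length_G_cycle nth_G_cycle cycle_node_eq_iff)

lemma set_G_cycle_nodes: "g \<ge> 3 \<Longrightarrow> set (G_cycle g i j) = cycle_node g i j ` {..<g}"
proof -
  assume g: "g \<ge> 3"
  have "set (G_cycle g i j) = (!) (G_cycle g i j) ` {..<g}"
    using g nth_image[of g "G_cycle g i j"] by (simp add: length_G_cycle atLeast0LessThan)
  also have "\<dots> = cycle_node g i j ` {..<g}"
    using g by (intro image_cong) (auto simp: nth_G_cycle)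
  finally show ?thesis .
qed

lemma set_G_cycle: 
  "g \<ge> 3 \<Longrightarrow> set (G_cycle g i j) = {PathV i, PathV (i+1)} \<union> CycV i j ` {1..g-2}"
  by (auto simp: G_cycle_def)

lemma cycle_edges_G_cycle:
  assumes "g \<ge> 3"
  shows "cycle_edges (G_cycle g i j) =
    insert {PathV i, PathV (i+1)} ((\<lambda>k. {cycle_node g i j k, cycle_node g i j (Suc k)}) ` {..<g-1})"
proof -
  have *: "{..<g} = insert (g-1) {..<g-1}" using assms by auto
  have "cycle_edges (G_cycle g i j) = (\<lambda>k. {cycle_node g i j k, cycle_node g i j (Suc k mod g)}) ` {..<g}"
  proof -
    have "cycle_edges xs = (\<lambda>k. {xs ! k, xs ! (Suc k mod length xs)}) ` {..<length xs}" for xs :: "vertex list"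
      by (auto simp: cycle_edges_def)
    then show ?thesis using assms by (auto simp: length_G_cycle nth_G_cycle intro!: image_cong)
  qed
  also have "\<dots> = insert {PathV i, PathV (i+1)} ((\<lambda>k. {cycle_node g i j k, cycle_node g i j (Suc k)}) ` {..<g-1})"
  proof -
    have "{cycle_node g i j (g-1), cycle_node g i j (Suc (g-1) mod g)} = {PathV i, PathV (i+1)}"
      using assms by (auto simp: cycle_node_def)
    moreover have "(\<lambda>k. {cycle_node g i j k, cycle_node g i j (Suc k mod g)}) ` {..<g-1} =
      (\<lambda>k. {cycle_node g i j k, cycle_node g i j (Suc k)}) ` {..<g-1}"
      by (rule image_cong) auto
    ultimately show ?thesis unfolding * image_insert by simp
  qed
  finally show ?thesis .
qed

lemma Union_cycle_edges: "\<Union> (cycle_edges xs) = set xs"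
proof (intro equalityI subsetI)
  fix v assume "v \<in> \<Union> (cycle_edges xs)"
  then obtain k where "k < length xs" "v \<in> {xs ! k, xs ! (Suc k mod length xs)}"
    by (auto simp: cycle_edges_def)
  moreover from this have "Suc k mod length xs < length xs" by (intro mod_less_divisor) linarith
  ultimately show "v \<in> set xs" by auto
next
  fix v assume "v \<in> set xs"
  then show "v \<in> \<Union> (cycle_edges xs)" unfolding cycle_edges_def in_set_conv_nth by blast
qed

text \<open>
  Length at least three is what makes the edges of the list pairwise different: two positions with
  the same edge would each be the cyclic successor of the other.
\<close>

lemma card_cycle_edges:
  assumes "distinct xs" "length xs \<ge> 3"
  shows "card (cycle_edges xs) = length xs"
proof -
  let ?n = "length xs"
  let ?e = "\<lambda>k. {xs ! k, xs ! (Suc k mod ?n)}"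
  have "inj_on ?e {..<?n}"
  proof (rule inj_onI)
    fix k m assume km: "k \<in> {..<?n}" "m \<in> {..<?n}" "?e k = ?e m"
    have "0 < ?n" using assms(2) by linarith
    then have lt: "Suc k mod ?n < ?n" "Suc m mod ?n < ?n" by auto
    from km have "k = m \<or> (k = Suc m mod ?n \<and> m = Suc k mod ?n)"
      using assms(1) lt by (auto simp: doubleton_eq_iff nth_eq_iff_index_eq)
    then show "k = m" using assms(2) km
      by (auto simp: mod_Suc split: if_splits)
  qed
  then have "card (?e ` {..<?n}) = ?n" by (simp add: card_image)
  moreover have "cycle_edges xs = ?e ` {..<?n}" by (auto simp: cycle_edges_def)
  ultimately show ?thesis by simp
qed

lemma cycle_two_neighbours:
  assumes "distinct xs" "length xs \<ge> 3" "v \<in> set xs"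
  obtains u w where "u \<in> set xs" "w \<in> set xs" "u \<noteq> w" "{v,u} \<in> cycle_edges xs" "{v,w} \<in> cycle_edges xs"
proof -
  let ?n = "length xs"
  have n: "0 < ?n" using assms(2) by linarith
  obtain k where k: "k < ?n" "v = xs ! k" using assms(3) by (auto simp: in_set_conv_nth)
  \<comment> \<open>The cyclic predecessor of \<open>k\<close>; it differs from the successor since the length is not two.\<close>
  define p where "p = (if k = 0 then ?n - 1 else k - 1)"
  have p: "p < ?n" "Suc p mod ?n = k" using k n by (auto simp: p_def)
  have s: "Suc k mod ?n < ?n" using n by simp
  have "p \<noteq> Suc k mod ?n" using assms(2) k by (auto simp: p_def mod_Suc split: if_splits)
  then have ne: "xs ! p \<noteq> xs ! (Suc k mod ?n)" using assms(1) p(1) s by (simp add: nth_eq_iff_index_eq)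
  have "{v, xs ! p} = {xs ! p, xs ! (Suc p mod ?n)}" using k p by auto
  then have "{v, xs ! p} \<in> cycle_edges xs" using p(1) unfolding cycle_edges_def by blast
  moreover have "{v, xs ! (Suc k mod ?n)} \<in> cycle_edges xs" using k unfolding cycle_edges_def by blast
  ultimately show ?thesis using that[OF _ _ ne] p s by auto
qed

lemma G_edge_cases:
  assumes "g \<ge> 3" "e \<in> G_edges a b g"
  obtains i where "i \<in> {1..a}" "e = {PathV i, PathV (i+1)}"
  | i j k where "i \<in> {1..a}" "j \<in> {1..b}" "k < g - 1" "e = {cycle_node g i j k, cycle_node g i j (Suc k)}"
  using assms unfolding G_edges_def by (auto simp: cycle_edges_G_cycle)

text \<open>
  Vertices off the path have degree two; this is what forces a cycle through one of them to follow
  the whole arc.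
\<close>

lemma CycV_neighbours:
  assumes "g \<ge> 3" "{CycV i j k, u} \<in> G_edges a b g"
  shows "i \<in> {1..a} \<and> j \<in> {1..b} \<and> k \<in> {1..g-2} \<and> (u = cycle_node g i j (k - 1) \<or> u = cycle_node g i j (k + 1))"
  using assms(1,2)
proof (cases rule: G_edge_cases)
  case (1 i)
  then show ?thesis by (auto simp: doubleton_eq_iff)
next
  case (2 i' j' k')
  then show ?thesis using assms(1)
    by (auto simp: doubleton_eq_iff cycle_node_def split: if_splits)
qed

text \<open>
  The cycles have no chords: two of them share path vertices only, at most $v_i$ and $v_{i+1}$, and the edge
  between these belongs to every cycle of that index \<open>i\<close>.
\<close>

lemma G_cycle_induced:
  assumes "g \<ge> 3" "e \<in> G_edges a b g" "e \<subseteq> set (G_cycle g i j)"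
  shows "e \<in> cycle_edges (G_cycle g i j)"
  using assms(1,2)
proof (cases rule: G_edge_cases)
  case (1 i')
  then show ?thesis using assms(1,3)
    by (auto simp: set_G_cycle cycle_edges_G_cycle)
next
  case (2 i' j' k')
  show ?thesis
  proof (cases "i' = i \<and> j' = j")
    case True
    then show ?thesis using 2 assms(1) by (auto simp: cycle_edges_G_cycle)
  next
    case False
    \<comment> \<open>Each edge of an arc has an end off the path, and such a vertex lies on one cycle only, so \<open>e\<close> cannot lie inside another cycle.\<close>
    with 2 assms(1,3) show ?thesis
      by (auto simp: set_G_cycle cycle_node_def split: if_splits)
  qed
qed

text \<open>
  If \<open>S\<close> contains a vertex off the path, then it contains both neighbours of that vertex, hence
  by propagation in both directions a whole arc with its two ends. Otherwise \<open>S\<close> lies on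
  the path, and there its last vertex has only one possible neighbour in \<open>S\<close>.
\<close>

lemma min_degree_two_contains_G_cycle:
  assumes g: "g \<ge> 3" and S: "finite S" "S \<noteq> {}"
    and deg: "\<And>v. v \<in> S \<Longrightarrow>
      \<exists>u w. u \<in> S \<and> w \<in> S \<and> u \<noteq> w \<and> {v,u} \<in> G_edges a b g \<and> {v,w} \<in> G_edges a b g"
  obtains i j where "i \<in> {1..a}" "j \<in> {1..b}" "set (G_cycle g i j) \<subseteq> S"
proof (cases "\<exists>i j k. CycV i j k \<in> S")
  case True
  then obtain i j k where ijk: "CycV i j k \<in> S" by blast
  have nbrs: "cycle_node g i j (m - 1) \<in> S \<and> cycle_node g i j (m + 1) \<in> S \<and> i \<in> {1..a} \<and> j \<in> {1..b} \<and> m \<in> {1..g-2}"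
    if m: "CycV i j m \<in> S" for m
  proof -
    obtain u w where uw: "u \<in> S" "w \<in> S" "u \<noteq> w"
      and e: "{CycV i j m,u} \<in> G_edges a b g" "{CycV i j m,w} \<in> G_edges a b g"
      using deg[OF m] by blast
    from CycV_neighbours[OF g e(1)] CycV_neighbours[OF g e(2)] uw
    show ?thesis by auto
  qed
  have cyc: "cycle_node g i j m = CycV i j m" if "m \<in> {1..g-2}" for m
    using that by (auto simp: cycle_node_def)
  have k: "k \<in> {1..g-2}" using nbrs[OF ijk] by blast
  have up: "m < g \<longrightarrow> cycle_node g i j m \<in> S" if "k \<le> m" for m
    using that
  proof (induction rule: dec_induct)
    case base
    then show ?case using cyc[OF k] ijk by simp
  next
    case (step m)
    then show ?case using cyc[of m] k nbrs[of m] by auto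
  qed
  have down: "cycle_node g i j m \<in> S" if "m \<le> k" for m
    using that
  proof (induction rule: inc_induct)
    case base
    then show ?case using cyc[OF k] ijk by simp
  next
    case (step m)
    then show ?case using cyc[of "Suc m"] k nbrs[of "Suc m"] by auto
  qed
  have "set (G_cycle g i j) \<subseteq> S"
    using up down by (auto simp: set_G_cycle_nodes[OF g]) (meson nat_le_linear)
  with nbrs[OF ijk] that show ?thesis by blast
next
  case False
  then have path: "\<exists>i. v = PathV i" if "v \<in> S" for v using that by (cases v) auto
  define I where "I = {i. PathV i \<in> S}"
  have I: "finite I" "I \<noteq> {}"
    using S path unfolding I_def by (auto intro: finite_vimageI[unfolded vimage_def] simp: inj_def)
  define m where "m = Max I"
  have m: "PathV m \<in> S" and m_max: "\<And>i. PathV i \<in> S \<Longrightarrow> i \<le> m"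
    using Max_in[OF I] Max_ge[OF I(1)] by (auto simp: m_def I_def)
  \<comment> \<open>The successor of the last path vertex is not in \<open>S\<close>, so only its predecessor is left.\<close>
  have nb: "u = PathV (m - 1)" if u: "u \<in> S" "{PathV m, u} \<in> G_edges a b g" for u
  proof -
    obtain i where i: "u = PathV i" "i \<le> m" using path[OF u(1)] m_max u(1) by blast
    show ?thesis using g u(2)
    proof (cases rule: G_edge_cases)
      case (1 i')
      then show ?thesis using i by (auto simp: doubleton_eq_iff)
    next
      case (2 i' j' k')
      then show ?thesis using i g
        by (auto simp: doubleton_eq_iff cycle_node_def split: if_splits)
    qed
  qed
  from deg[OF m] nb show ?thesis by blast
qed

lemma G_cycle_in_cycles:
  assumes "g \<ge> 3" "i \<in> {1..a}" "j \<in> {1..b}"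
  shows "cycle_edges (G_cycle g i j) \<in> cycles g (G_verts a b g) (G_edges a b g)"
proof -
  have "set (G_cycle g i j) \<subseteq> G_verts a b g"
    using assms by (auto simp: set_G_cycle G_verts_def)
  moreover have "cycle_edges (G_cycle g i j) \<subseteq> G_edges a b g"
    using assms by (auto simp: G_edges_def)
  ultimately show ?thesis
    using assms length_G_cycle[of g i j] distinct_G_cycle[of g i j] unfolding cycles_def by auto
qed

text \<open>
  The vertex set of a \<open>g\<close>-cycle spans a graph of minimum degree two, so it contains the
  vertex set of some \<open>G_cycle g i j\<close>, which also has \<open>g\<close> elements. The two vertex sets
  agree, all edges of the given cycle are edges of the chordless \<open>G_cycle g i j\<close>, and both cycles
  have \<open>g\<close> edges. In particular the cycles formed by two different arcs from $v_i$ to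
  $v_{i+1}$ do not count: their length is \<open>2 * g - 2\<close>, which exceeds \<open>g\<close>.
\<close>

lemma cycles_G:
  assumes g: "g \<ge> 3"
  shows "cycles g (G_verts a b g) (G_edges a b g) =
    (\<lambda>(i, j). cycle_edges (G_cycle g i j)) ` ({1..a} \<times> {1..b})"
proof (intro equalityI subsetI)
  fix C assume "C \<in> cycles g (G_verts a b g) (G_edges a b g)"
  then obtain xs where xs: "C = cycle_edges xs" "length xs = g" "distinct xs"
      "set xs \<subseteq> G_verts a b g" "cycle_edges xs \<subseteq> G_edges a b g"
    by (auto simp: cycles_def)
  have deg: "\<exists>u w. u \<in> set xs \<and> w \<in> set xs \<and> u \<noteq> w \<and> {v,u} \<in> G_edges a b g \<and> {v,w} \<in> G_edges a b g"
    if "v \<in> set xs" for v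
    using cycle_two_neighbours[of xs v] that xs g by (metis subsetD)
  obtain i j where ij: "i \<in> {1..a}" "j \<in> {1..b}" "set (G_cycle g i j) \<subseteq> set xs"
    by (rule min_degree_two_contains_G_cycle[OF g _ _ deg]) (use xs g in auto)
  have "card (set (G_cycle g i j)) = g" "card (set xs) = g"
    using g xs by (simp_all add: distinct_card distinct_G_cycle length_G_cycle)
  with ij(3) have eq: "set (G_cycle g i j) = set xs"
    by (intro card_subset_eq) auto
  have "cycle_edges xs \<subseteq> cycle_edges (G_cycle g i j)"
  proof
    fix e assume "e \<in> cycle_edges xs"
    then show "e \<in> cycle_edges (G_cycle g i j)"
      using xs(5) Union_cycle_edges[of xs] eq by (intro G_cycle_induced[OF g]) auto
  qed
  moreover have "card (cycle_edges xs) = card (cycle_edges (G_cycle g i j))"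
    using xs g by (simp add: card_cycle_edges distinct_G_cycle length_G_cycle)
  moreover have "finite (cycle_edges (G_cycle g i j))" by (simp add: cycle_edges_G_cycle[OF g])
  ultimately have "cycle_edges xs = cycle_edges (G_cycle g i j)" by (intro card_subset_eq) auto
  then show "C \<in> (\<lambda>(i, j). cycle_edges (G_cycle g i j)) ` ({1..a} \<times> {1..b})" using xs ij by auto
next
  fix C assume "C \<in> (\<lambda>(i, j). cycle_edges (G_cycle g i j)) ` ({1..a} \<times> {1..b})"
  then show "C \<in> cycles g (G_verts a b g) (G_edges a b g)" using G_cycle_in_cycles[OF g] by auto
qed

lemma inj_G_cycle:
  assumes g: "g \<ge> 3"
  shows "inj_on (\<lambda>(i, j). cycle_edges (G_cycle g i j)) A"
proof (rule inj_onI, clarify)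
  fix i j i' j' assume "cycle_edges (G_cycle g i j) = cycle_edges (G_cycle g i' j')"
  then have "set (G_cycle g i j) = set (G_cycle g i' j')" by (metis Union_cycle_edges)
  moreover have "CycV i j 1 \<in> set (G_cycle g i j)" using g by (auto simp: set_G_cycle)
  ultimately show "i = i' \<and> j = j'" using g by (auto simp: set_G_cycle)
qed

definition mono_cycle where
  "mono_cycle g Y i j \<longleftrightarrow> Y (PathV (i + 1)) = Y (PathV i) \<and> (\<forall>k\<in>{1..g-2}. Y (CycV i j k) = Y (PathV i))"

lemma Z_eq_card:
  assumes g: "g \<ge> 3"
  shows "Z a b g Y = card {(i, j) \<in> {1..a} \<times> {1..b}. mono_cycle g Y i j}"
proof -
  have mono: "monochromatic Y (cycle_edges (G_cycle g i j)) \<longleftrightarrow> mono_cycle g Y i j" for i j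
    unfolding monochromatic_def Union_cycle_edges mono_cycle_def using g by (auto simp: set_G_cycle)
  have "{C \<in> cycles g (G_verts a b g) (G_edges a b g). monochromatic Y C} =
    (\<lambda>(i, j). cycle_edges (G_cycle g i j)) ` {(i, j) \<in> {1..a} \<times> {1..b}. mono_cycle g Y i j}"
    unfolding cycles_G[OF g] using mono by auto
  then show ?thesis
    unfolding Z_def num_mono_cycles_def by (simp add: card_image inj_G_cycle[OF g])
qed

lemma power_Z:
  fixes s :: "'a :: comm_monoid_mult"
  assumes g: "g \<ge> 3"
  shows "s ^ Z a b g Y = (\<Prod>i=1..a. \<Prod>j=1..b. if mono_cycle g Y i j then s else 1)"
proof -
  have "(\<Prod>i=1..a. \<Prod>j=1..b. if mono_cycle g Y i j then s else 1) =
    (\<Prod>p\<in>{1..a} \<times> {1..b}. if mono_cycle g Y (fst p) (snd p) then s else 1)"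
    by (simp add: prod.cartesian_product case_prod_unfold)
  also have "\<dots> = s ^ Z a b g Y"
    unfolding Z_eq_card[OF g]
    by (simp add: prod.If_cases del: One_nat_def)
      (auto intro!: arg_cong[where f = "\<lambda>A. s ^ card A"])
  finally show ?thesis by simp
qed

section \<open>The generating function of the number of monochromatic cycles\<close>

text \<open>
  Fubini for product measures over disjoint index sets. Finite supports make every integrand
  integrable, so that it applies to complex-valued functions.
\<close>

lemma expectation_Pi_pmf_union:
  fixes f :: "('v \<Rightarrow> 'c) \<Rightarrow> complex"
  assumes A: "finite A" "finite B" "A \<inter> B = {}" and p: "\<And>x. finite (set_pmf (p x))"
  shows "measure_pmf.expectation (Pi_pmf (A \<union> B) d p) f =
    measure_pmf.expectation (Pi_pmf A d p) (\<lambda>h.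
      measure_pmf.expectation (Pi_pmf B d p) (\<lambda>k. f (\<lambda>x. if x \<in> A then h x else k x)))"
proof -
  have fin: "finite (set_pmf (Pi_pmf A d p))" "finite (set_pmf (Pi_pmf B d p))"
    using A p by (auto simp: set_Pi_pmf)
  show ?thesis
    unfolding Pi_pmf_union[OF A] pair_pmf_def
    using fin by (simp add: pmf_expectation_bind[OF fin(1)] integral_measure_pmf[OF fin(1)]
      map_pmf_def[symmetric] case_prod_unfold cong: if_cong)
qed

lemma expectation_Pi_pmf_indep:
  fixes F H :: "('v \<Rightarrow> 'c) \<Rightarrow> complex"
  assumes A: "finite A" "finite B" "A \<inter> B = {}" and p: "\<And>x. finite (set_pmf (p x))"
    and F: "\<And>h k. (\<And>x. x \<in> A \<Longrightarrow> h x = k x) \<Longrightarrow> F h = F k"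
    and H: "\<And>h k. (\<And>x. x \<in> B \<Longrightarrow> h x = k x) \<Longrightarrow> H h = H k"
  shows "measure_pmf.expectation (Pi_pmf (A \<union> B) d p) (\<lambda>y. F y * H y) =
    measure_pmf.expectation (Pi_pmf A d p) F * measure_pmf.expectation (Pi_pmf B d p) H"
proof -
  have "F (\<lambda>x. if x \<in> A then h x else k x) = F h" for h k by (rule F) auto
  moreover have "H (\<lambda>x. if x \<in> A then h x else k x) = H k" for h k
    by (rule H) (use A in auto)
  ultimately show ?thesis by (subst expectation_Pi_pmf_union[OF A p]) auto
qed

lemma prob_all_of_color:
  assumes "finite K" "y \<in> {1..c}"
  shows "measure_pmf.expectation (uniform_coloring K c) (\<lambda>h. of_bool (\<forall>v\<in>K. h v = y)) = (1 / of_nat c ^ card K :: complex)"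
proof -
  have c: "{1..c} \<noteq> {}" using assms by auto
  have "measure_pmf.expectation (uniform_coloring K c) (\<lambda>h. of_bool (\<forall>v\<in>K. h v = y)) =
    complex_of_real (measure_pmf.expectation (uniform_coloring K c) (\<lambda>h. of_bool (\<forall>v\<in>K. h v = y)))"
    unfolding integral_complex_of_real[symmetric] by (intro Bochner_Integration.integral_cong) auto
  also have "measure_pmf.expectation (uniform_coloring K c) (\<lambda>h. of_bool (\<forall>v\<in>K. h v = y)) =
     measure_pmf.expectation (uniform_coloring K c) (\<lambda>h. \<Prod>v\<in>K. of_bool (h v = y) :: real)"
  proof -
    have "of_bool (\<forall>v\<in>K. h v = y) = (\<Prod>v\<in>K. of_bool (h v = y) :: real)" for h
      using assms(1) by (induction rule: finite_induct) auto
    then show ?thesis by simp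
  qed
  also have "\<dots> = (\<Prod>v\<in>K. measure_pmf.expectation (pmf_of_set {1..c}) (\<lambda>x. of_bool (x = y)))"
    unfolding uniform_coloring_def using assms c
    by (intro expectation_prod_Pi_pmf) (auto intro!: integrable_measure_pmf_finite)
  also have "\<dots> = (1 / real c) ^ card K"
    using assms c by (simp add: integral_pmf_of_set of_bool_def sum.delta)
  finally show ?thesis by (simp add: power_one_over)
qed

definition interior_verts where
  "interior_verts g i b = {CycV i j k | j k. j \<in> {1..b} \<and> k \<in> {1..g-2}}"

lemma finite_interior_verts: "finite (interior_verts g i b)"
proof -
  have "interior_verts g i b = (\<lambda>(j,k). CycV i j k) ` ({1..b} \<times> {1..g-2})" by (auto simp: interior_verts_def)
  then show ?thesis by simp
qed

text \<open>
  Once $v_i$ and $v_{i+1}$ share the color \<open>y\<close>, the \<open>b\<close> cycles through them are monochromatic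
  independently of each other, each with probability $c^{-(g-2)}$; the right-hand side is
  the generating function of this binomial law.
\<close>

lemma pgf_interior_verts:
  fixes s :: complex
  assumes y: "y \<in> {1..c}"
  shows "measure_pmf.expectation (uniform_coloring (interior_verts g i b) c)
     (\<lambda>h. \<Prod>j=1..b. if \<forall>k\<in>{1..g-2}. h (CycV i j k) = y then s else 1) =
     (1 + (s - 1) / of_nat c ^ (g - 2)) ^ b"
proof (induction b)
  case 0
  have "interior_verts g i 0 = {}" by (auto simp: interior_verts_def)
  then show ?case by (simp add: uniform_coloring_def)
next
  case (Suc b)
  let ?K = "CycV i (Suc b) ` {1..g-2}"
  let ?G = "\<lambda>h. if \<forall>k\<in>{1..g-2}. h (CycV i (Suc b) k) = y then s else 1"
  have c: "{1..c} \<noteq> {}" using y by auto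
  have un: "interior_verts g i (Suc b) = interior_verts g i b \<union> ?K" by (auto simp: interior_verts_def le_Suc_eq)
  have card: "card ?K = g - 2" by (simp add: card_image inj_on_def)
  have fin: "finite (set_pmf (uniform_coloring ?K c))"
    using c by (auto simp: uniform_coloring_def set_Pi_pmf)
  have "measure_pmf.expectation (uniform_coloring ?K c) ?G =
    measure_pmf.expectation (uniform_coloring ?K c) (\<lambda>h. 1 + (s - 1) * of_bool (\<forall>v\<in>?K. h v = y))"
    by (intro Bochner_Integration.integral_cong) auto
  also have "\<dots> = 1 + (s - 1) / of_nat c ^ (g - 2)"
    using prob_all_of_color[of ?K y c] y card
    by (subst Bochner_Integration.integral_add)
       (use fin in \<open>auto intro!: integrable_measure_pmf_finite\<close>)
  finally have K: "measure_pmf.expectation (uniform_coloring ?K c) ?G = 1 + (s - 1) / of_nat c ^ (g - 2)" .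
  have "measure_pmf.expectation (uniform_coloring (interior_verts g i (Suc b)) c)
     (\<lambda>h. \<Prod>j=1..Suc b. if \<forall>k\<in>{1..g-2}. h (CycV i j k) = y then s else 1) =
     measure_pmf.expectation (uniform_coloring (interior_verts g i b \<union> ?K) c)
     (\<lambda>h. (\<Prod>j=1..b. if \<forall>k\<in>{1..g-2}. h (CycV i j k) = y then s else 1) * ?G h)"
    by (simp add: un mult.commute)
  also have "\<dots> = measure_pmf.expectation (uniform_coloring (interior_verts g i b) c)
      (\<lambda>h. \<Prod>j=1..b. if \<forall>k\<in>{1..g-2}. h (CycV i j k) = y then s else 1) *
      measure_pmf.expectation (uniform_coloring ?K c) ?G"
    unfolding uniform_coloring_def using c
    by (intro expectation_Pi_pmf_indep finite_interior_verts)
       (auto simp: interior_verts_def intro!: prod.cong)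
  finally show ?case unfolding Suc.IH K by (simp add: mult.commute)
qed

text \<open>
  Lengthening the path by one edge adds a vertex $v_{a+2}$, which takes the color \<open>y\<close> of $v_{a+1}$ with
  probability $1/c$. Only in this case can the \<open>b\<close> new cycles be monochromatic. The result does not
  depend on \<open>y\<close>, which is why the blocks contribute independently.
\<close>

lemma pgf_new_block:
  fixes s :: complex and a b g :: nat
  defines "B \<equiv> insert (PathV (a + 2)) (interior_verts g (a + 1) b)"
  assumes y: "y \<in> {1..c}"
  shows "measure_pmf.expectation (uniform_coloring B c)
      (\<lambda>h. \<Prod>j=1..b. if h (PathV (a+2)) = y \<and> (\<forall>k\<in>{1..g-2}. h (CycV (a+1) j k) = y) then s else 1)
    = 1 + ((1 + (s - 1) / of_nat c ^ (g - 2)) ^ b - 1) / of_nat c"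
proof -
  let ?q = "(1 + (s - 1) / of_nat c ^ (g - 2)) ^ b"
  let ?P = "{PathV (a + 2)}"
  have c: "{1..c} \<noteq> {}" using y by auto
  have B: "B = ?P \<union> interior_verts g (a + 1) b" by (simp add: B_def)
  have fin: "finite (set_pmf (uniform_coloring ?P c))"
    using c by (auto simp: uniform_coloring_def set_Pi_pmf)
  have inner: "measure_pmf.expectation (uniform_coloring (interior_verts g (a+1) b) c)
      (\<lambda>k. \<Prod>j=1..b. if (if PathV (a+2) \<in> ?P then h (PathV (a+2)) else k (PathV (a+2))) = y \<and>
         (\<forall>m\<in>{1..g-2}. (if CycV (a+1) j m \<in> ?P then h (CycV (a+1) j m) else k (CycV (a+1) j m)) = y) then s else 1)
    = 1 + (?q - 1) * of_bool (\<forall>v\<in>?P. h v = y)" for h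
    using pgf_interior_verts[OF y, of g "a+1" b s] by (cases "h (PathV (a+2)) = y") auto
  have "measure_pmf.expectation (uniform_coloring B c)
      (\<lambda>h. \<Prod>j=1..b. if h (PathV (a+2)) = y \<and> (\<forall>k\<in>{1..g-2}. h (CycV (a+1) j k) = y) then s else 1)
    = measure_pmf.expectation (uniform_coloring ?P c) (\<lambda>h. 1 + (?q - 1) * of_bool (\<forall>v\<in>?P. h v = y))"
  proof -
    have "?P \<inter> interior_verts g (a + 1) b = {}" by (auto simp: interior_verts_def)
    then show ?thesis
      unfolding B inner[symmetric] unfolding uniform_coloring_def
      using c by (subst expectation_Pi_pmf_union) (auto simp: finite_interior_verts cong: if_cong)
  qed
  also have "\<dots> = 1 + (?q - 1) / of_nat c"
    using prob_all_of_color[of ?P y c] y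
    by (subst Bochner_Integration.integral_add)
       (use fin in \<open>auto intro!: integrable_measure_pmf_finite\<close>)
  finally show ?thesis .
qed

text \<open>
  The new block meets the old graph only in $v_{a+1}$, and given any coloring of the old graph the
  expected contribution of the new block is the same constant, so each edge of the path
  contributes one equal factor.
\<close>

lemma pgf_Z:
  fixes s :: complex
  assumes g: "g \<ge> 3" and c: "c \<ge> 1"
  shows "measure_pmf.expectation (uniform_coloring (G_verts a b g) c) (\<lambda>Y. s ^ Z a b g Y) =
    (1 + ((1 + (s - 1) / of_nat c ^ (g - 2)) ^ b - 1) / of_nat c) ^ a"
proof (induction a)
  case 0
  then show ?case by (simp add: power_Z[OF g])
next
  case (Suc a)
  let ?V = "G_verts a b g" and ?B = "insert (PathV (a + 2)) (interior_verts g (a + 1) b)"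
  let ?w = "\<lambda>i Y. \<Prod>j=1..b. if mono_cycle g Y i j then s else 1"
  let ?q = "1 + ((1 + (s - 1) / of_nat c ^ (g - 2)) ^ b - 1) / of_nat c"
  have Vpath: "PathV ` {1..Suc a + 1} = insert (PathV (a + 2)) (PathV ` {1..a+1})"
    by (simp add: atLeastAtMostSuc_conv)
  have V: "G_verts (Suc a) b g = ?V \<union> ?B" unfolding G_verts_def Vpath by (auto simp: interior_verts_def le_Suc_eq)
  have finV: "finite ?V"
  proof -
    have "?V = PathV ` {1..a+1} \<union> (\<Union>i\<in>{1..a}. interior_verts g i b)"
      by (auto simp: G_verts_def interior_verts_def)
    then show ?thesis by (simp add: finite_interior_verts)
  qed
  have disj: "?V \<inter> ?B = {}" by (auto simp: G_verts_def interior_verts_def)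
  have split: "s ^ Z (Suc a) b g Y = s ^ Z a b g Y * ?w (a + 1) Y" for Y :: "vertex \<Rightarrow> nat"
    by (simp add: power_Z[OF g])
  \<comment> \<open>The first factor sees only the old vertices, the second one also the color of $v_{a+1}$.\<close>
  have old: "s ^ Z a b g (\<lambda>x. if x \<in> ?V then h x else k x) = s ^ Z a b g h" for h k :: "vertex \<Rightarrow> nat"
    unfolding power_Z[OF g]
    by (intro prod.cong refl if_cong) (auto simp: mono_cycle_def G_verts_def)
  have new: "?w (a + 1) (\<lambda>x. if x \<in> ?V then h x else k x) =
     (\<Prod>j=1..b. if k (PathV (a+2)) = h (PathV (a+1)) \<and> (\<forall>m\<in>{1..g-2}. k (CycV (a+1) j m) = h (PathV (a+1))) then s else 1)"
     for h k :: "vertex \<Rightarrow> nat"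
    by (intro prod.cong refl if_cong) (auto simp: mono_cycle_def G_verts_def)
  have step: "measure_pmf.expectation (uniform_coloring ?B c) (\<lambda>k. ?w (a + 1) (\<lambda>x. if x \<in> ?V then h x else k x)) = ?q"
    if "h \<in> set_pmf (uniform_coloring ?V c)" for h
  proof -
    have "h (PathV (a+1)) \<in> {1..c}"
      using that finV c by (auto simp: uniform_coloring_def set_Pi_pmf PiE_dflt_def G_verts_def)
    then show ?thesis unfolding new by (intro pgf_new_block) auto
  qed
  have "measure_pmf.expectation (uniform_coloring (?V \<union> ?B) c) (\<lambda>Y. s ^ Z (Suc a) b g Y) =
    measure_pmf.expectation (uniform_coloring ?V c) (\<lambda>h. s ^ Z a b g h *
      measure_pmf.expectation (uniform_coloring ?B c) (\<lambda>k. ?w (a + 1) (\<lambda>x. if x \<in> ?V then h x else k x)))"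
    unfolding uniform_coloring_def
    by (subst expectation_Pi_pmf_union) (use disj finV c in \<open>simp_all add: finite_interior_verts split old\<close>)
  also have "\<dots> = measure_pmf.expectation (uniform_coloring ?V c) (\<lambda>h. s ^ Z a b g h * ?q)"
    using step by (intro integral_cong_AE) (auto simp: AE_measure_pmf_iff)
  also have "\<dots> = ?q ^ Suc a" using Suc.IH by simp
  finally show ?case unfolding V .
qed

section \<open>Generating functions of Poisson and mixed Poisson laws\<close>

lemma expectation_nat_sums:
  fixes f :: "nat \<Rightarrow> complex"
  assumes "\<And>k. norm (f k) \<le> B"
  shows "(\<lambda>k. of_real (pmf p k) * f k) sums measure_pmf.expectation p f"
proof -
  have int: "integrable (measure_pmf p) f"
    by (rule measure_pmf.integrable_const_bound[where B = B]) (use assms in auto)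
  then have "integrable (count_space UNIV) (\<lambda>k. pmf p k *\<^sub>R f k)"
    unfolding measure_pmf_eq_density by (subst (asm) integrable_density) auto
  from sums_integral_count_space_nat[OF this] show ?thesis
    unfolding measure_pmf_eq_density by (subst integral_density) (auto simp: scaleR_conv_of_real)
qed

lemma poisson_sums:
  fixes s :: complex
  shows "(\<lambda>k. of_real (1 / fact k * exp (- w) * w ^ k) * s ^ k) sums exp (of_real w * (s - 1))"
proof -
  have "(\<lambda>k. exp (- of_real w) * ((of_real w * s) ^ k /\<^sub>R fact k)) sums (exp (- of_real w) * exp (of_real w * s))"
    by (intro sums_mult exp_converges)
  then show ?thesis
    by (simp add: mult_exp_exp scaleR_conv_of_real algebra_simps divide_inverse exp_of_real[symmetric])
qed

lemma pgf_poisson: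
  fixes s :: complex
  assumes "l > 0" "norm s \<le> 1"
  shows "measure_pmf.expectation (poisson_pmf l) (\<lambda>k. s ^ k) = exp (of_real l * (s - 1))"
proof -
  have "(\<lambda>k. of_real (pmf (poisson_pmf l) k) * s ^ k) sums measure_pmf.expectation (poisson_pmf l) (\<lambda>k. s ^ k)"
    by (rule expectation_nat_sums[where B = 1]) (use assms in \<open>simp add: norm_power power_le_one\<close>)
  moreover have "of_real (pmf (poisson_pmf l) k) * s ^ k = of_real (1 / fact k * exp (- l) * l ^ k) * s ^ k" for k
    using assms by simp
  ultimately show ?thesis using poisson_sums[of l s] by (simp add: sums_unique2)
qed

text \<open>
  Exchanging the sum over \<open>k\<close> with the expectation reduces this to the Poisson series. The
  exchange is allowed because for \<open>norm s \<le> 1\<close> the terms are dominated by the Poisson weights, whose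
  expectations add up to one.
\<close>

lemma pgf_mixed_poisson:
  fixes s :: complex
  assumes M: "prob_space M" and W [measurable]: "W \<in> borel_measurable M"
    and nonneg: "AE \<omega> in M. 0 \<le> W \<omega>" and s: "norm s \<le> 1"
  shows "measure_pmf.expectation (mixed_poisson M W) (\<lambda>k. s ^ k) = (\<integral>\<omega>. exp (of_real (W \<omega>) * (s - 1)) \<partial>M)"
proof -
  interpret prob_space M by fact
  let ?p = "\<lambda>k \<omega>. 1 / fact k * exp (- W \<omega>) * W \<omega> ^ k"
  have sum1: "(\<lambda>k. 1 / fact k * exp (- w) * w ^ k) sums 1" for w :: real
  proof -
    have "(\<lambda>k. exp (- w) * (w ^ k /\<^sub>R fact k)) sums (exp (- w) * exp w)"
      by (intro sums_mult exp_converges)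
    then show ?thesis by (simp add: mult_exp_exp field_simps)
  qed
  have p_le: "1 / fact k * exp (- w) * w ^ k \<le> 1" if "0 \<le> w" for w :: real and k
    using sum_le_suminf[OF sums_summable[OF sum1], of "{k}" w] sums_unique[OF sum1, of w] that by simp
  have intp: "integrable M (?p k)" for k
    by (rule integrable_const_bound[where B = 1]) (use nonneg in \<open>eventually_elim, use p_le in auto\<close>, measurable)
  have norm_sk: "norm (s ^ k) \<le> 1" for k using s by (simp add: norm_power power_le_one)
  have int: "integrable M (\<lambda>\<omega>. of_real (?p k \<omega>) * s ^ k)" for k
    using intp[of k] by (intro integrable_mult_left integrable_of_real)
  have AE_norm: "AE \<omega> in M. \<forall>k. norm (of_real (?p k \<omega>) * s ^ k) \<le> ?p k \<omega>"
    using nonneg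
  proof eventually_elim
    case (elim \<omega>)
    have "norm (of_real (?p k \<omega>) * s ^ k) = ?p k \<omega> * norm (s ^ k)" for k
      using elim by (simp only: norm_mult norm_of_real) simp
    moreover have "?p k \<omega> * norm (s ^ k) \<le> ?p k \<omega>" for k
      using elim by (intro mult_left_le[OF norm_sk]) simp
    ultimately show ?case by simp
  qed
  have norm_le: "(\<integral>\<omega>. norm (of_real (?p k \<omega>) * s ^ k) \<partial>M) \<le> pmf (mixed_poisson M W) k" for k
    unfolding pmf_mixed_poisson[OF M W nonneg]
    by (intro integral_mono_AE integrable_norm int intp) (use AE_norm in eventually_elim, blast)
  have "summable (pmf (mixed_poisson M W))"
    using sums_summable[OF expectation_nat_sums[of "\<lambda>_. 1" 1 "mixed_poisson M W"]] by simp
  then have sum_int: "summable (\<lambda>k. \<integral>\<omega>. norm (of_real (?p k \<omega>) * s ^ k) \<partial>M)"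
    by (rule summable_comparison_test'[where N = 0]) (use norm_le in auto)
  have AE_sum: "AE \<omega> in M. summable (\<lambda>k. norm (of_real (?p k \<omega>) * s ^ k))"
    using AE_norm
  proof eventually_elim
    case (elim \<omega>)
    then show ?case
      by (intro summable_comparison_test'[OF sums_summable[OF sum1[of "W \<omega>"]], where N = 0]) auto
  qed
  have "(\<lambda>k. \<integral>\<omega>. of_real (?p k \<omega>) * s ^ k \<partial>M) sums (\<integral>\<omega>. (\<Sum>k. of_real (?p k \<omega>) * s ^ k) \<partial>M)"
    by (rule sums_integral[OF int AE_sum sum_int])
  moreover have "(\<integral>\<omega>. of_real (?p k \<omega>) * s ^ k \<partial>M) = of_real (pmf (mixed_poisson M W) k) * s ^ k" for k
    unfolding pmf_mixed_poisson[OF M W nonneg] by (simp only: integral_mult_left_zero integral_complex_of_real)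
  moreover have "(\<Sum>k. of_real (?p k \<omega>) * s ^ k) = exp (of_real (W \<omega>) * (s - 1))" for \<omega>
    using poisson_sums[of "W \<omega>" s] by (simp only: sums_iff)
  moreover have "(\<lambda>k. of_real (pmf (mixed_poisson M W) k) * s ^ k) sums measure_pmf.expectation (mixed_poisson M W) (\<lambda>k. s ^ k)"
    by (rule expectation_nat_sums[OF norm_sk])
  ultimately show ?thesis by (simp add: sums_unique2)
qed

section \<open>Passage to the limit\<close>

text \<open>
  Complex version of $(1 + z/n)^n \to e^z$ with perturbed base and exponent: take logarithms and
  use that $\ln(1+u)$ differs from $u$ only by $O(|u|^2)$.
\<close>

lemma tendsto_power_exp:
  fixes u :: "nat \<Rightarrow> complex" and a :: "nat \<Rightarrow> nat"
  assumes u: "u \<longlonglongrightarrow> 0" and au: "(\<lambda>n. of_nat (a n) * u n) \<longlonglongrightarrow> z"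
  shows "(\<lambda>n. (1 + u n) ^ a n) \<longlonglongrightarrow> exp z"
proof -
  have small: "\<forall>\<^sub>F n in sequentially. norm (u n) < 1/2"
    using tendstoD[OF u, of "1/2"] by simp
  have err0: "(\<lambda>n. norm (of_nat (a n) * u n) * norm (u n) * 2) \<longlonglongrightarrow> norm z * norm (0::complex) * 2"
    by (intro tendsto_intros au u)
  have "(\<lambda>n. of_nat (a n) * (ln (1 + u n) - u n)) \<longlonglongrightarrow> 0"
  proof (rule Lim_null_comparison)
    show "\<forall>\<^sub>F n in sequentially. norm (of_nat (a n) * (ln (1 + u n) - u n)) \<le> norm (of_nat (a n) * u n) * norm (u n) * 2"
      using small
    proof eventually_elim
      case (elim n)
      have "norm (ln (1 + u n) - u n) \<le> norm (u n)^2 / (1 - norm (u n))"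
        by (rule Ln_approx_linear) (use elim in simp)
      also have "\<dots> \<le> norm (u n)^2 / (1/2)"
        using elim by (intro divide_left_mono) auto
      finally have "norm (ln (1 + u n) - u n) \<le> norm (u n) * norm (u n) * 2"
        by (simp add: power2_eq_square)
      then have "real (a n) * norm (ln (1 + u n) - u n) \<le> real (a n) * (norm (u n) * norm (u n) * 2)"
        by (intro mult_left_mono) auto
      then show ?case by (simp add: norm_mult mult.assoc)
    qed
  qed (use err0 in simp)
  from tendsto_add[OF this au] have "(\<lambda>n. of_nat (a n) * ln (1 + u n)) \<longlonglongrightarrow> z"
    by (simp add: algebra_simps)
  then have "(\<lambda>n. exp (of_nat (a n) * ln (1 + u n))) \<longlonglongrightarrow> exp z" by (intro tendsto_intros)
  moreover have "\<forall>\<^sub>F n in sequentially. exp (of_nat (a n) * ln (1 + u n)) = (1 + u n) ^ a n"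
    using small
  proof eventually_elim
    case (elim n)
    then have "1 + u n \<noteq> 0" by (auto simp: add_eq_0_iff)
    then show ?case by (simp add: exp_of_nat_mult)
  qed
  ultimately show ?thesis by (rule Lim_transform_eventually)
qed

text \<open>
  Two nested exponential limits: the inner power tends to $e^{s-1}$, the generating function of
  $\mathrm{Poisson}(1)$, and the outer one turns a sum of about $\lambda n$ independent terms, each
  nonzero with probability of order $1/n$, into a compound Poisson law.
\<close>

lemma pgf_limit:
  fixes s :: complex and l :: real
  assumes m: "m \<ge> 1" and l: "l > 0"
  shows "(\<lambda>n. (1 + ((1 + (s - 1) / of_nat n ^ m) ^ (n ^ m) - 1) / of_nat n) ^ nat \<lfloor>l * real n\<rfloor>)
    \<longlonglongrightarrow> exp (of_real l * (exp (s - 1) - 1))"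
proof -
  have inv: "(\<lambda>n. inverse (of_nat n :: complex)) \<longlonglongrightarrow> 0" by (rule lim_inverse_n)
  have q: "(\<lambda>n. (1 + (s - 1) / of_nat n ^ m) ^ (n ^ m)) \<longlonglongrightarrow> exp (s - 1)"
  proof (rule tendsto_power_exp)
    have "(\<lambda>n. (s - 1) * inverse (of_nat n) ^ m) \<longlonglongrightarrow> (s - 1) * 0 ^ m"
      by (intro tendsto_intros inv)
    then show "(\<lambda>n. (s - 1) / of_nat n ^ m) \<longlonglongrightarrow> 0"
      using m by (simp add: divide_inverse power_inverse power_0_left)
    show "(\<lambda>n. of_nat (n ^ m) * ((s - 1) / of_nat n ^ m)) \<longlonglongrightarrow> s - 1"
      by (rule tendsto_eventually, rule eventually_mono[OF eventually_gt_at_top[of 0]]) auto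
  qed
  have q1: "(\<lambda>n. (1 + (s - 1) / of_nat n ^ m) ^ (n ^ m) - 1) \<longlonglongrightarrow> exp (s - 1) - 1"
    by (intro tendsto_intros q)
  \<comment> \<open>Rounding \<open>l * n\<close> down does not change the rate.\<close>
  have ratio: "(\<lambda>n. real (nat \<lfloor>l * real n\<rfloor>) / real n) \<longlonglongrightarrow> l"
    using l by real_asymp
  show ?thesis
  proof (rule tendsto_power_exp)
    show "(\<lambda>n. ((1 + (s - 1) / of_nat n ^ m) ^ (n ^ m) - 1) / of_nat n) \<longlonglongrightarrow> 0"
      using tendsto_mult[OF q1 inv] by (simp add: field_simps)
    have "(\<lambda>n. of_real (real (nat \<lfloor>l * real n\<rfloor>) / real n) * ((1 + (s - 1) / of_nat n ^ m) ^ (n ^ m) - 1))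
       \<longlonglongrightarrow> of_real l * (exp (s - 1) - 1)"
      by (intro tendsto_mult tendsto_of_real ratio q1)
    then show "(\<lambda>n. of_nat (nat \<lfloor>l * real n\<rfloor>) * (((1 + (s - 1) / of_nat n ^ m) ^ (n ^ m) - 1) / of_nat n))
       \<longlonglongrightarrow> of_real l * (exp (s - 1) - 1)"
      by (simp add: field_simps)
  qed
qed

lemma char_distr_nat:
  fixes X :: "'a \<Rightarrow> nat"
  shows "char (distr (measure_pmf p) borel (\<lambda>x. real (X x))) t = measure_pmf.expectation p (\<lambda>x. iexp t ^ X x)"
proof -
  have "iexp (t * real k) = iexp t ^ k" for k
    by (simp add: exp_of_nat_mult[symmetric] algebra_simps)
  then show ?thesis unfolding char_def by (subst integral_distr) auto
qed

theorem proposition8p1: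
  fixes g :: nat and l :: real
  assumes "g \<ge> 3" and "l > 0"
  shows "weak_conv_m
    (\<lambda>n. let a = nat \<lfloor>l * real n\<rfloor>; b = n ^ (g - 2); c = n in
       distr (measure_pmf (uniform_coloring (G_verts a b g) c)) borel (\<lambda>Y. real (Z a b g Y)))
    (distr (measure_pmf (mixed_poisson (measure_pmf (poisson_pmf l)) real)) borel real)"
proof (rule levy_continuity)
  fix t :: real
  define s where "s = iexp t"
  have s: "norm s = 1" by (simp add: s_def)
  let ?a = "\<lambda>n. nat \<lfloor>l * real n\<rfloor>" and ?b = "\<lambda>n. n ^ (g - 2)"
  let ?Q = "mixed_poisson (measure_pmf (poisson_pmf l)) real"
  \<comment> \<open>The generating function of \<open>W\<close> is evaluated at $e^{s-1}$, in the unit disc since $\mathrm{Re}\, s \leq |s| = 1$.\<close>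
  have "norm (exp (s - 1)) \<le> 1"
    using complex_Re_le_cmod[of s] s by simp
  then have limit_pgf: "measure_pmf.expectation ?Q (\<lambda>k. s ^ k) = exp (of_real l * (exp (s - 1) - 1))"
    using pgf_poisson[OF assms(2), of "exp (s - 1)"] s
    by (subst pgf_mixed_poisson) (auto simp: measure_pmf.prob_space_axioms exp_of_nat_mult)
  have "(\<lambda>n. (1 + ((1 + (s - 1) / of_nat n ^ (g - 2)) ^ ?b n - 1) / of_nat n) ^ ?a n)
      \<longlonglongrightarrow> exp (of_real l * (exp (s - 1) - 1))"
    using assms by (intro pgf_limit) auto
  moreover have "\<forall>\<^sub>F n in sequentially. (1 + ((1 + (s - 1) / of_nat n ^ (g - 2)) ^ ?b n - 1) / of_nat n) ^ ?a n =
      measure_pmf.expectation (uniform_coloring (G_verts (?a n) (?b n) g) n) (\<lambda>Y. s ^ Z (?a n) (?b n) g Y)"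
    \<comment> \<open>For \<open>n = 0\<close> there are no colors.\<close>
    using eventually_ge_at_top[of 1]
    by eventually_elim (use pgf_Z[OF assms(1)] in simp)
  ultimately have "(\<lambda>n. measure_pmf.expectation (uniform_coloring (G_verts (?a n) (?b n) g) n) (\<lambda>Y. s ^ Z (?a n) (?b n) g Y))
      \<longlonglongrightarrow> measure_pmf.expectation ?Q (\<lambda>k. s ^ k)"
    unfolding limit_pgf by (rule Lim_transform_eventually)
  then show "(\<lambda>n. char (let a = ?a n; b = ?b n; c = n in
       distr (measure_pmf (uniform_coloring (G_verts a b g) c)) borel (\<lambda>Y. real (Z a b g Y))) t)
     \<longlonglongrightarrow> char (distr (measure_pmf ?Q) borel real) t"
    using char_distr_nat[of ?Q "\<lambda>k. k" t] by (simp add: Let_def char_distr_nat s_def)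
qed (auto simp: Let_def intro!: prob_space.real_distribution_distr measure_pmf.prob_space_axioms)

end
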